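(* Let $T=(V,E)$ be a leafless directed tree with a root, let $\lambda=\{\lambda_v\}_{v\in V}$ be a sequence of positive numbers, and let $1\le q<\infty$. Assume the backward shift operator $B:\mathbf{L}^q(T,\lambda)\to\mathbf{L}^q(T,\lambda)$ is bounded. For $u\in V$ and $n\in\mathbb{N}$ let $\gamma(u,n)$ be the cardinality of $\operatorname{Chi}^n(u)$ and $$\Omega(u,n):=\frac{1}{(\gamma(u,n))^q}\sum_{v\in\operatorname{Chi}^n(u)}\lambda_v .$$ If there exists an increasing sequence of natural numbers $\{n_k\}$ such that for all $u\in V$ we have $\Omega(u,n_k)\to 0$ as $k\to\infty$, then $B$ is hypercyclic.
   Context: A directed graph $T=(V,E)$ consists of a countably infinite set $V$ of vertices and a set $E\subseteq V\times V$ of directed edges; it is always assumed locally finite (every vertex has finite indegree and finite outdegree). $T$ is a directed tree if it has no directed circuits (including loops $(v,v)$), its underlying undirected graph is connected, and every vertex has indegree $0$ or $1$. A root is a vertex of indegree $0$ (there is at most one). A leaf is a vertex of outdegree $0$; leafless means having no leaf. If $v$ is not the root, its parent $\operatorname{par}(v)$ is the unique $u$ with $(u,v)\in E$; $\operatorname{par}^n$ denotes the $n$-fold iterate of $\operatorname{par}$, where defined. $\operatorname{Chi}(u)=\{v\in V:\operatorname{par}(v)=u\}$, and for $n\in\mathbb{N}=\{1,2,\dots\}$, $\operatorname{Chi}^n(u)=\{v\in V:\operatorname{par}^n(v)\text{ is defined and equals }u\}$. $\mathbf{L}^q(T,\lambda)$ is the complex Banach space of functions $f:V\to\mathbb{C}$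 with $\|f\|_q=\big(\sum_{v\in V}|f(v)|^q\lambda_v\big)^{1/q}<\infty$. The backward shift $B$ is defined by $(Bf)(u)=\sum_{v\in\operatorname{Chi}(u)}f(v)$ for $u\in V$. A bounded operator $A$ on a Banach space $\mathcal{B}$ is hypercyclic if there is $x\in\mathcal{B}$ such that $\{A^nx: n=0,1,2,\dots\}$ is dense in $\mathcal{B}$. "Increasing" means strictly increasing. *)

theory Defs
  imports "HOL-Analysis.Analysis"
begin

section \<open>Directed trees\<close>

text \<open>The edge \<open>(u, v)\<close> points from the parent \<open>u\<close> to the child \<open>v\<close>.\<close>

definition locally_finite_digraph :: "'v set \<Rightarrow> ('v \<times> 'v) set \<Rightarrow> bool" where
  "locally_finite_digraph V E \<longleftrightarrow>
     countable V \<and> infinite V \<and> E \<subseteq> V \<times> V \<and>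
     (\<forall>v\<in>V. finite {u. (u, v) \<in> E} \<and> finite {w. (v, w) \<in> E})"

definition indegree :: "('v \<times> 'v) set \<Rightarrow> 'v \<Rightarrow> nat" where
  "indegree E v = card {u. (u, v) \<in> E}"

definition outdegree :: "('v \<times> 'v) set \<Rightarrow> 'v \<Rightarrow> nat" where
  "outdegree E v = card {w. (v, w) \<in> E}"

definition directed_tree :: "'v set \<Rightarrow> ('v \<times> 'v) set \<Rightarrow> bool" where
  "directed_tree V E \<longleftrightarrow>
     locally_finite_digraph V E \<and>
     acyclic E \<and>
     (\<forall>u\<in>V. \<forall>v\<in>V. (u, v) \<in> (E \<union> E\<inverse>)\<^sup>*) \<and>
     (\<forall>v\<in>V. indegree E v = 0 \<or> indegree E v = 1)"

definition is_root :: "'v set \<Rightarrow> ('v \<times> 'v) set \<Rightarrow> 'v \<Rightarrow> bool" where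
  "is_root V E r \<longleftrightarrow> r \<in> V \<and> indegree E r = 0"

definition leafless :: "'v set \<Rightarrow> ('v \<times> 'v) set \<Rightarrow> bool" where
  "leafless V E \<longleftrightarrow> (\<forall>v\<in>V. outdegree E v \<noteq> 0)"

text \<open>The parent is a partial function: \<open>None\<close> means undefined, as happens at the root.\<close>

definition par :: "('v \<times> 'v) set \<Rightarrow> 'v \<Rightarrow> 'v option" where
  "par E v = (if \<exists>u. (u, v) \<in> E then Some (THE u. (u, v) \<in> E) else None)"

primrec par_iter :: "('v \<times> 'v) set \<Rightarrow> nat \<Rightarrow> 'v \<Rightarrow> 'v option" where
  "par_iter E 0 v = Some v"
| "par_iter E (Suc n) v = Option.bind (par_iter E n v) (par E)"

definition Chi :: "'v set \<Rightarrow> ('v \<times> 'v) set \<Rightarrow> 'v \<Rightarrow> 'v set" where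
  "Chi V E u = {v \<in> V. par E v = Some u}"

definition Chi_n :: "'v set \<Rightarrow> ('v \<times> 'v) set \<Rightarrow> nat \<Rightarrow> 'v \<Rightarrow> 'v set" where
  "Chi_n V E n u = {v \<in> V. par_iter E n v = Some u}"


section \<open>The weighted space and the backward shift\<close>

text \<open>
  A function \<open>V \<rightarrow> \<complex>\<close> is represented by its extension by zero to the whole type, so that
  equality of elements is equality on \<open>V\<close>.
\<close>

definition Lq :: "'v set \<Rightarrow> ('v \<Rightarrow> real) \<Rightarrow> real \<Rightarrow> ('v \<Rightarrow> complex) set" where
  "Lq V lam q =
     {f. (\<forall>v. v \<notin> V \<longrightarrow> f v = 0) \<and> (\<lambda>v. cmod (f v) powr q * lam v) summable_on V}"

definition Lq_norm :: "'v set \<Rightarrow> ('v \<Rightarrow> real) \<Rightarrow> real \<Rightarrow> ('v \<Rightarrow> complex) \<Rightarrow> real" where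
  "Lq_norm V lam q f = (\<Sum>\<^sub>\<infinity>v\<in>V. cmod (f v) powr q * lam v) powr (1 / q)"

definition backward_shift ::
    "'v set \<Rightarrow> ('v \<times> 'v) set \<Rightarrow> ('v \<Rightarrow> complex) \<Rightarrow> ('v \<Rightarrow> complex)" where
  "backward_shift V E f = (\<lambda>u. if u \<in> V then \<Sum>v\<in>Chi V E u. f v else 0)"


section \<open>Bounded and hypercyclic operators\<close>

text \<open>\<open>X\<close> is the carrier of a normed space of functions (pointwise operations) with norm \<open>N\<close>.\<close>

definition bounded_operator ::
    "('v \<Rightarrow> complex) set \<Rightarrow> (('v \<Rightarrow> complex) \<Rightarrow> real) \<Rightarrow>
     (('v \<Rightarrow> complex) \<Rightarrow> ('v \<Rightarrow> complex)) \<Rightarrow> bool" where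
  "bounded_operator X N A \<longleftrightarrow>
     (\<forall>f\<in>X. A f \<in> X) \<and>
     (\<forall>f\<in>X. \<forall>g\<in>X. A (\<lambda>v. f v + g v) = (\<lambda>v. A f v + A g v)) \<and>
     (\<forall>c. \<forall>f\<in>X. A (\<lambda>v. c * f v) = (\<lambda>v. c * A f v)) \<and>
     (\<exists>C. \<forall>f\<in>X. N (A f) \<le> C * N f)"

definition hypercyclic ::
    "('v \<Rightarrow> complex) set \<Rightarrow> (('v \<Rightarrow> complex) \<Rightarrow> real) \<Rightarrow>
     (('v \<Rightarrow> complex) \<Rightarrow> ('v \<Rightarrow> complex)) \<Rightarrow> bool" where
  "hypercyclic X N A \<longleftrightarrow>
     bounded_operator X N A \<and>
     (\<exists>x\<in>X. \<forall>y\<in>X. \<forall>\<epsilon>>0. \<exists>n. N (\<lambda>v. (A ^^ n) x v - y v) < \<epsilon>)"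


section \<open>The averaged weights\<close>

definition gam :: "'v set \<Rightarrow> ('v \<times> 'v) set \<Rightarrow> 'v \<Rightarrow> nat \<Rightarrow> nat" where
  "gam V E u n = card (Chi_n V E n u)"

definition Omega ::
    "'v set \<Rightarrow> ('v \<times> 'v) set \<Rightarrow> ('v \<Rightarrow> real) \<Rightarrow> real \<Rightarrow> 'v \<Rightarrow> nat \<Rightarrow> real" where
  "Omega V E lam q u n =
     1 / (real (gam V E u n) powr q) * (\<Sum>v\<in>Chi_n V E n u. lam v)"

end

theory Submission
  imports Defs
begin

text \<open>
  On finitely supported functions \<open>B\<^sup>n\<close> is eventually zero because the tree is rooted, and it has a
  right inverse \<open>S\<^sub>n\<close> that distributes the mass at \<open>u\<close> equally over \<open>Chi\<^sup>n(u)\<close>; the \<open>q\<close>-th power of the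
  norm of the image of the unit mass at \<open>u\<close> is exactly \<open>\<Omega>(u, n)\<close>. Let \<open>y\<^sub>i\<close> run infinitely
  often through a countable dense set of finitely supported functions, and choose \<open>m\<^sub>0 < m\<^sub>1 < \<dots>\<close>
  in the given sequence, growing so fast that the functions \<open>S y\<^sub>i\<close> with \<open>S = S\<^sub>n\<close> for
  \<open>n = m\<^sub>i\<close> occupy disjoint ranges of generations and their norms beat the norms of all
  earlier powers of \<open>B\<close>. The sum \<open>x\<close> of these functions is hypercyclic: the power \<open>m\<^sub>j\<close> of \<open>B\<close>
  kills the terms \<open>i < j\<close>, maps the term \<open>j\<close> to \<open>y\<^sub>j\<close>, and leaves a tail tending to zero.
  Working with \<open>q\<close>-th powers of norms and disjoint supports, neither Minkowski's inequality nor
  completeness is needed.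
\<close>

section \<open>Two elementary estimates\<close>

lemma sum_half_powers_le:
  assumes "finite J" "J \<subseteq> {j..}"
  shows "(\<Sum>i\<in>J. (1 / 2) ^ i) \<le> 2 * (1 / 2 :: real) ^ j"
proof -
  have half: "(1 / 2 :: real) ^ Suc n = (1 / 2) ^ n / 2" for n
    by simp
  obtain N where N: "J \<subseteq> {..<N}"
    using finite_nat_iff_bounded[of J] assms(1) by blast
  have "(\<Sum>i\<in>J. (1 / 2) ^ i) \<le> (\<Sum>i = j..<j + N. (1 / 2 :: real) ^ i)"
    using assms N by (intro sum_mono2) fastforce+
  also have "\<dots> = 2 * (1 / 2) ^ j - 2 * (1 / 2) ^ (j + N)"
    by (induction N) (simp_all add: half del: power_Suc power_one_over)
  also have "\<dots> \<le> 2 * (1 / 2) ^ j"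
    by simp
  finally show ?thesis .
qed

text \<open>The larger of the two norms controls the sum up to a factor 2. The constant
  \<open>2 powr q\<close> is absorbed when the tolerance is chosen at the end.\<close>

lemma norm_add_powr_le:
  fixes a b :: "'a :: real_normed_vector"
  assumes "0 \<le> q"
  shows "norm (a + b) powr q \<le> 2 powr q * (norm a powr q + norm b powr q)"
proof -
  have "norm (a + b) \<le> 2 * max (norm a) (norm b)"
    using norm_triangle_ineq[of a b] by linarith
  then have "norm (a + b) powr q \<le> (2 * max (norm a) (norm b)) powr q"
    using assms by (intro powr_mono2) auto
  also have "\<dots> = 2 powr q * max (norm a) (norm b) powr q"
    by (simp add: powr_mult)
  also have "\<dots> \<le> 2 powr q * (norm a powr q + norm b powr q)"
    by (intro mult_left_mono) (auto simp: max_def)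
  finally show ?thesis .
qed


section \<open>The weighted space\<close>

text \<open>Leaving out the root makes this functional additive over disjoint supports.\<close>

definition Lq_pow :: "'v set \<Rightarrow> ('v \<Rightarrow> real) \<Rightarrow> real \<Rightarrow> ('v \<Rightarrow> complex) \<Rightarrow> real" where
  "Lq_pow V lam q f = (\<Sum>\<^sub>\<infinity>v\<in>V. cmod (f v) powr q * lam v)"

context
  fixes V :: "'v set" and lam :: "'v \<Rightarrow> real" and q :: real
  assumes lam: "\<forall>v\<in>V. lam v > 0" and q: "1 \<le> q"
begin

lemma lam_nonneg: "v \<in> V \<Longrightarrow> 0 \<le> lam v"
  using lam by (simp add: less_imp_le)

lemma Lq_pow_nonneg: "0 \<le> Lq_pow V lam q f"
  unfolding Lq_pow_def by (intro infsum_nonneg) (simp add: lam_nonneg)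

lemma Lq_norm_powr: "Lq_norm V lam q f powr q = Lq_pow V lam q f"
  using q Lq_pow_nonneg[of f] by (simp add: Lq_norm_def Lq_pow_def powr_powr)

lemma Lq_norm_less_iff:
  assumes "0 < e"
  shows "Lq_norm V lam q f < e \<longleftrightarrow> Lq_pow V lam q f < e powr q"
proof -
  have "0 \<le> Lq_norm V lam q f"
    by (simp add: Lq_norm_def)
  then show ?thesis
    using q assms powr_mono2[of q e "Lq_norm V lam q f"]
      powr_less_mono2[of q "Lq_norm V lam q f" e] by (fastforce simp: Lq_norm_powr[symmetric])
qed

text \<open>The terms are nonnegative, so bounded finite partial sums already give summability; one
  estimate yields both membership and the bound.\<close>

lemma Lq_boundedI:
  assumes "\<And>v. v \<notin> V \<Longrightarrow> f v = 0"
    and "\<And>F. finite F \<Longrightarrow> F \<subseteq> V \<Longrightarrow> (\<Sum>v\<in>F. cmod (f v) powr q * lam v) \<le> C"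
  shows "f \<in> Lq V lam q" "Lq_pow V lam q f \<le> C"
proof -
  have s: "(\<lambda>v. cmod (f v) powr q * lam v) summable_on V"
    by (rule nonneg_bdd_above_summable_on) (auto simp: lam_nonneg intro!: bdd_aboveI2 assms(2))
  then show "f \<in> Lq V lam q"
    using assms(1) by (simp add: Lq_def)
  show "Lq_pow V lam q f \<le> C"
    unfolding Lq_pow_def using s assms(2) by (rule infsum_le_finite_sums)
qed

lemma Lq_pow_add_le:
  assumes "f \<in> Lq V lam q" "g \<in> Lq V lam q"
  shows "(\<lambda>v. f v + g v) \<in> Lq V lam q"
    and "Lq_pow V lam q (\<lambda>v. f v + g v) \<le> 2 powr q * (Lq_pow V lam q f + Lq_pow V lam q g)"
proof -
  let ?t = "\<lambda>f v. cmod (f v) powr q * lam v"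
  have "(\<Sum>v\<in>F. ?t (\<lambda>v. f v + g v) v) \<le> 2 powr q * (Lq_pow V lam q f + Lq_pow V lam q g)"
    if F: "finite F" "F \<subseteq> V" for F
  proof -
    have "(\<Sum>v\<in>F. ?t (\<lambda>v. f v + g v) v) \<le> (\<Sum>v\<in>F. 2 powr q * (?t f v + ?t g v))"
    proof (rule sum_mono)
      fix v assume "v \<in> F"
      then have "?t (\<lambda>v. f v + g v) v \<le> 2 powr q * (cmod (f v) powr q + cmod (g v) powr q) * lam v"
        using F q by (intro mult_right_mono norm_add_powr_le lam_nonneg) auto
      then show "?t (\<lambda>v. f v + g v) v \<le> 2 powr q * (?t f v + ?t g v)"
        by (simp add: algebra_simps)
    qed
    also have "\<dots> = 2 powr q * ((\<Sum>v\<in>F. ?t f v) + (\<Sum>v\<in>F. ?t g v))"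
      by (simp add: sum.distrib flip: sum_distrib_left)
    also have "\<dots> \<le> 2 powr q * (Lq_pow V lam q f + Lq_pow V lam q g)"
      unfolding Lq_pow_def using assms F
      by (intro mult_left_mono add_mono finite_sum_le_infsum) (auto simp: Lq_def lam_nonneg)
    finally show ?thesis .
  qed
  moreover have "v \<notin> V \<Longrightarrow> f v + g v = 0" for v
    using assms by (simp add: Lq_def)
  ultimately show "(\<lambda>v. f v + g v) \<in> Lq V lam q"
    and "Lq_pow V lam q (\<lambda>v. f v + g v) \<le> 2 powr q * (Lq_pow V lam q f + Lq_pow V lam q g)"
    using Lq_boundedI[of "\<lambda>v. f v + g v"] by blast+
qed

lemma Lq_uminus: "f \<in> Lq V lam q \<Longrightarrow> (\<lambda>v. - f v) \<in> Lq V lam q"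
  by (simp add: Lq_def)

lemma finite_support_in_Lq:
  assumes "finite A" "A \<subseteq> V" "\<And>v. v \<notin> A \<Longrightarrow> f v = 0"
  shows "f \<in> Lq V lam q"
proof (rule Lq_boundedI)
  fix F assume F: "finite F" "F \<subseteq> V"
  have "(\<Sum>v\<in>F. cmod (f v) powr q * lam v) = (\<Sum>v\<in>F \<inter> A. cmod (f v) powr q * lam v)"
    using F assms by (intro sum.mono_neutral_right) auto
  also have "\<dots> \<le> (\<Sum>v\<in>A. cmod (f v) powr q * lam v)"
    using assms by (intro sum_mono2) (auto intro!: mult_nonneg_nonneg lam_nonneg)
  finally show "(\<Sum>v\<in>F. cmod (f v) powr q * lam v) \<le> (\<Sum>v\<in>A. cmod (f v) powr q * lam v)" .
qed (use assms in auto)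

lemma bounded_operator_iterates:
  assumes "bounded_operator (Lq V lam q) (Lq_norm V lam q) A"
  shows "\<exists>K\<ge>1. \<forall>f\<in>Lq V lam q. \<forall>n.
    (A ^^ n) f \<in> Lq V lam q \<and> Lq_pow V lam q ((A ^^ n) f) \<le> K ^ n * Lq_pow V lam q f"
proof -
  obtain C where C: "\<And>f. f \<in> Lq V lam q \<Longrightarrow> Lq_norm V lam q (A f) \<le> C * Lq_norm V lam q f"
    using assms unfolding bounded_operator_def by blast
  \<comment> \<open>\<open>C\<close> might be negative or below 1; the maximum makes
    \<open>K ^ n\<close> nondecreasing in \<open>n\<close>.\<close>
  define K where "K = max 1 C powr q"
  have K: "1 \<le> K"
    unfolding K_def using q by (intro ge_one_powr_ge_zero) auto
  have mem: "(A ^^ n) f \<in> Lq V lam q" if "f \<in> Lq V lam q" for f n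
    using that assms by (induction n) (auto simp: bounded_operator_def)
  have step: "Lq_pow V lam q (A f) \<le> K * Lq_pow V lam q f" if f: "f \<in> Lq V lam q" for f
  proof -
    have nn: "0 \<le> Lq_norm V lam q g" for g
      by (simp add: Lq_norm_def)
    have "Lq_norm V lam q (A f) \<le> max 1 C * Lq_norm V lam q f"
      using C[OF f] mult_right_mono[of C "max 1 C", OF _ nn[of f]] by linarith
    then have "Lq_norm V lam q (A f) powr q \<le> (max 1 C * Lq_norm V lam q f) powr q"
      using q nn by (intro powr_mono2) auto
    then show ?thesis
      using nn[of f] by (simp add: powr_mult Lq_norm_powr K_def)
  qed
  have "Lq_pow V lam q ((A ^^ n) f) \<le> K ^ n * Lq_pow V lam q f" if f: "f \<in> Lq V lam q" for f n
  proof (induction n)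
    case (Suc n)
    have "Lq_pow V lam q ((A ^^ Suc n) f) \<le> K * Lq_pow V lam q ((A ^^ n) f)"
      using step[OF mem[OF f]] by simp
    also have "\<dots> \<le> K * (K ^ n * Lq_pow V lam q f)"
      using Suc K by (intro mult_left_mono) auto
    finally show ?case
      by (simp add: mult.assoc)
  qed simp
  with K mem show ?thesis by blast
qed

text \<open>Association lists over \<open>V\<close> and a countable dense set of scalars are
  countable and encode finitely supported functions. To approximate \<open>f\<close>, cut it off
  outside a finite set and perturb the remaining values.\<close>

lemma Lq_dense_sequence:
  assumes "countable V" "V \<noteq> {}"
  shows "\<exists>(y :: nat \<Rightarrow> 'v \<Rightarrow> complex) A.
    (\<forall>i. finite (A i) \<and> A i \<subseteq> V \<and> (\<forall>v. v \<notin> A i \<longrightarrow> y i v = 0)) \<and>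
    (\<forall>f\<in>Lq V lam q. \<forall>e>0. \<exists>i. Lq_pow V lam q (\<lambda>v. y i v - f v) < e)"
proof -
  obtain D :: "complex set" where "countable D"
    and D: "\<And>U. open U \<Longrightarrow> U \<noteq> {} \<Longrightarrow> \<exists>d\<in>D. d \<in> U"
    by (rule countable_dense_setE) blast
  define L where "L = lists (V \<times> D)"
  define val :: "('v \<times> complex) list \<Rightarrow> 'v \<Rightarrow> complex"
    where "val l v = (case map_of l v of None \<Rightarrow> 0 | Some c \<Rightarrow> c)" for l v
  define y where "y i = val (from_nat_into L i)" for i
  define A where "A i = fst ` set (from_nat_into L i)" for i
  have L: "countable L" "L \<noteq> {}"
    using \<open>countable D\<close> assms by (auto simp: L_def)
  have "A i \<subseteq> V" for i
    using from_nat_into[OF L(2), of i] by (fastforce simp: A_def L_def)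
  moreover have "y i v = 0" if "v \<notin> A i" for i v
    using that map_of_eq_None_iff[of "from_nat_into L i" v] by (simp add: A_def y_def val_def)
  moreover have "\<exists>i. Lq_pow V lam q (\<lambda>v. y i v - f v) < e" if f: "f \<in> Lq V lam q" and e: "0 < e" for f e
  proof -
    let ?t = "\<lambda>v. cmod (f v) powr q * lam v"
    have sf: "?t summable_on V"
      using f by (simp add: Lq_def)
    then obtain F where F: "finite F" "F \<subseteq> V" and *: "norm (sum ?t F - infsum ?t V) \<le> e / 3"
      using infsum_finite_approximation[of ?t V "e / 3"] e by (auto simp: dist_norm)
    have "infsum ?t V = infsum ?t F + infsum ?t (V - F)"
      using F sf infsum_Un_disjoint[of ?t F "V - F"]
      by (auto simp: Un_absorb1 summable_on_subset_banach)
    then have tail: "infsum ?t (V - F) \<le> e / 3"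
      using * F by simp
    \<comment> \<open>Tail and head each cost at most \<open>e / 3\<close>, leaving room for
      strictness; the added 1 covers empty \<open>F\<close>.\<close>
    define h where "h = e / (3 * (1 + real (card F)))"
    have h: "0 < h"
      using e by (simp add: h_def add_pos_nonneg)
    have "\<exists>c\<in>D. cmod (c - f v) powr q * lam v < h" if "v \<in> V" for v
    proof -
      define d where "d = (h / lam v) powr (1 / q)"
      have "0 < lam v" "0 < d"
        using that lam h by (auto simp: d_def)
      then obtain c where c: "c \<in> D" "cmod (c - f v) < d"
        using D[of "ball (f v) d"] by (auto simp: dist_norm norm_minus_commute)
      then have "cmod (c - f v) powr q < d powr q"
        using q by (intro powr_less_mono2) auto
      also have "d powr q = h / lam v"
        using q h \<open>0 < lam v\<close> by (simp add: d_def powr_powr)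
      finally show ?thesis
        using c \<open>0 < lam v\<close> by (auto simp: field_simps)
    qed
    then obtain c where c: "\<And>v. v \<in> V \<Longrightarrow> c v \<in> D"
      "\<And>v. v \<in> V \<Longrightarrow> cmod (c v - f v) powr q * lam v < h"
      by metis
    obtain xs where xs: "set xs = F"
      using F(1) finite_list by blast
    define l where "l = map (\<lambda>v. (v, c v)) xs"
    have "l \<in> L"
      using xs F by (auto simp: l_def L_def intro!: c(1))
    then obtain i where i: "from_nat_into L i = l"
      using L from_nat_into_surj by metis
    have val: "y i v = (if v \<in> F then c v else 0)" for v
      using xs by (simp add: y_def i val_def l_def map_of_map_restrict restrict_map_def)
    let ?g = "\<lambda>v. cmod (y i v - f v) powr q * lam v"
    have "Lq_pow V lam q (\<lambda>v. y i v - f v) = sum ?g F + infsum ?g (V - F)"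
    proof -
      have "?g summable_on (V - F) \<longleftrightarrow> ?t summable_on (V - F)"
        by (intro summable_on_cong) (simp add: val)
      then have "?g summable_on (V - F)"
        using sf by (auto simp: summable_on_subset_banach)
      then show ?thesis
        using F infsum_Un_disjoint[of ?g F "V - F"] by (simp add: Lq_pow_def Un_absorb1)
    qed
    also have "infsum ?g (V - F) = infsum ?t (V - F)"
      by (intro infsum_cong) (simp add: val)
    also have "sum ?g F \<le> (\<Sum>v\<in>F. h)"
      using c F by (intro sum_mono) (auto simp: val less_imp_le)
    also have "(\<Sum>v\<in>F. h) \<le> e / 3"
      using e by (simp add: h_def field_simps)
    finally have "Lq_pow V lam q (\<lambda>v. y i v - f v) \<le> e / 3 + e / 3"
      using tail by simp
    with e show ?thesis
      by (intro exI[of _ i]) linarith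
  qed
  ultimately show ?thesis
    by (intro exI[of _ y] exI[of _ A]) (simp add: A_def)
qed

end


section \<open>Generations and the right inverse of the shift\<close>

text \<open>\<open>par_iter\<close> unfolds at the ancestor end; this allows splitting at the end of
  \<open>v\<close> as well.\<close>

lemma par_iter_add:
  "par_iter E (m + n) v = Option.bind (par_iter E m v) (par_iter E n)"
  by (induction n) (auto split: bind_splits)

text \<open>In a rooted tree this counts the vertices on the path from the root, so the root has
  depth 1.\<close>

definition depth :: "('v \<times> 'v) set \<Rightarrow> 'v \<Rightarrow> nat" where
  "depth E v = (LEAST n. par_iter E n v = None)"

text \<open>The right inverse of the \<open>n\<close>-th power of the shift. Vertices without an
  \<open>n\<close>-th ancestor get 0.\<close>

definition spread :: "'v set \<Rightarrow> ('v \<times> 'v) set \<Rightarrow> nat \<Rightarrow> ('v \<Rightarrow> complex) \<Rightarrow> 'v \<Rightarrow> complex" where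
  "spread V E n f v = (case par_iter E n v of None \<Rightarrow> 0 | Some u \<Rightarrow> f u / of_nat (gam V E u n))"

locale leafless_rooted_tree =
  fixes V :: "'v set" and E :: "('v \<times> 'v) set"
  assumes tree: "directed_tree V E" and no_leaf: "leafless V E" and ex_root: "\<exists>r. is_root V E r"
begin

section \<open>Parents and depth in the rooted tree\<close>

lemma edge_in_V: "(u, v) \<in> E \<Longrightarrow> u \<in> V \<and> v \<in> V"
  using tree by (auto simp: directed_tree_def locally_finite_digraph_def)

text \<open>\<open>card\<close> is 0 on infinite sets, so the indegree condition yields a unique
  parent only together with local finiteness.\<close>

lemma par_eq_Some_iff: "par E v = Some u \<longleftrightarrow> (u, v) \<in> E"
proof -
  have "{u. (u, v) \<in> E} = {w}" if "(w, v) \<in> E" for w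
  proof -
    have "finite {u. (u, v) \<in> E}" "card {u. (u, v) \<in> E} \<le> 1"
      using tree edge_in_V[OF that]
      by (auto simp: directed_tree_def locally_finite_digraph_def indegree_def)
    then show ?thesis
      using that card_le_Suc0_iff_eq[of "{u. (u, v) \<in> E}"] by auto
  qed
  then have "(THE u. (u, v) \<in> E) = w" if "(w, v) \<in> E" for w
    using that by (intro the_equality) auto
  then show ?thesis
    by (auto simp: par_def)
qed

text \<open>Induction along an undirected path. A forward edge extends the directed path; a backward
  edge leads to the unique parent of the current vertex, which the directed path has just
  visited.\<close>

lemma root_reaches:
  assumes "is_root V E r" "v \<in> V"
  shows "(r, v) \<in> E\<^sup>*"
proof -
  have "(r, v) \<in> (E \<union> E\<inverse>)\<^sup>*"
    using assms tree by (auto simp: directed_tree_def is_root_def)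
  then show ?thesis
  proof (induction rule: rtrancl_induct)
    case (step v w)
    show ?case
    proof (cases "(v, w) \<in> E")
      case True
      with step show ?thesis by simp
    next
      case False
      with step have wv: "(w, v) \<in> E" by blast
      \<comment> \<open>No edge enters the root, so \<open>v\<close> is not \<open>r\<close> and the
        directed path to \<open>v\<close> has a last edge.\<close>
      have "finite {u. (u, r) \<in> E}" "card {u. (u, r) \<in> E} = 0"
        using assms(1) tree
        by (auto simp: is_root_def indegree_def directed_tree_def locally_finite_digraph_def)
      then have "(w, r) \<notin> E" by auto
      with wv step.IH obtain z where "(r, z) \<in> E\<^sup>*" "(z, v) \<in> E"
        by (metis rtranclE)
      with wv show ?thesis
        by (metis option.inject par_eq_Some_iff)
    qed
  qed simp
qed

lemma par_iter_eventually_None: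
  assumes "v \<in> V"
  shows "\<exists>n. par_iter E n v = None"
proof -
  obtain r where r: "is_root V E r"
    using ex_root ..
  from root_reaches[OF r assms] show ?thesis
  proof (induction rule: rtrancl_induct)
    case base
    have "finite {u. (u, r) \<in> E}" "card {u. (u, r) \<in> E} = 0"
      using r tree
      by (auto simp: is_root_def indegree_def directed_tree_def locally_finite_digraph_def)
    then have "par E r = None"
      by (auto simp: par_def)
    then have "par_iter E 1 r = None" by simp
    then show ?case ..
  next
    case (step u v)
    then obtain n where "par_iter E n u = None" by blast
    with step have "par_iter E (1 + n) v = None"
      by (subst par_iter_add) (simp add: par_eq_Some_iff[THEN iffD2])
    then show ?case ..
  qed
qed

text \<open>Once an iterate of the parent map is undefined, all later ones are.\<close>

lemma less_depth_iff:
  assumes "v \<in> V"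
  shows "n < depth E v \<longleftrightarrow> par_iter E n v \<noteq> None"
proof
  assume "par_iter E n v \<noteq> None"
  moreover have "par_iter E (depth E v) v = None"
    unfolding depth_def using par_iter_eventually_None[OF assms] by (rule LeastI_ex)
  then have "par_iter E n v = None" if "depth E v \<le> n"
    using that par_iter_add[of E "depth E v" "n - depth E v" v] by simp
  ultimately show "n < depth E v"
    by (meson not_le)
qed (auto simp: depth_def dest: not_less_Least)

lemma par_iter_in_V:
  assumes "v \<in> V" "par_iter E n v = Some u"
  shows "u \<in> V"
  using assms by (induction n arbitrary: u) (auto simp: bind_eq_Some_conv par_eq_Some_iff dest: edge_in_V)

lemma depth_eq_add:
  assumes "v \<in> V" "par_iter E n v = Some u"
  shows "depth E v = n + depth E u"
proof -
  \<comment> \<open>The depths are compared through the numbers lying below them.\<close>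
  have "n + k < depth E v \<longleftrightarrow> k < depth E u" for k
    using assms par_iter_in_V[OF assms] by (simp add: less_depth_iff par_iter_add)
  moreover have "n < depth E v"
    using assms by (simp add: less_depth_iff)
  ultimately show ?thesis
    by (metis add_less_cancel_left le_add_diff_inverse less_imp_le linorder_neqE_nat nat_less_le)
qed

lemma depth_pos: "v \<in> V \<Longrightarrow> 0 < depth E v"
  by (simp add: less_depth_iff)

section \<open>Generations of descendants\<close>

lemma Chi_eq: "Chi V E u = {v. (u, v) \<in> E}"
  by (auto simp: Chi_def par_eq_Some_iff dest: edge_in_V)

lemma finite_Chi: "finite (Chi V E u)"
proof (cases "u \<in> V")
  case True
  then show ?thesis
    using tree by (auto simp: Chi_eq directed_tree_def locally_finite_digraph_def)
next
  case False
  then have "Chi V E u = {}"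
    by (auto simp: Chi_eq dest: edge_in_V)
  then show ?thesis by simp
qed

lemma Chi_nonempty: "u \<in> V \<Longrightarrow> Chi V E u \<noteq> {}"
  using no_leaf by (metis Chi_eq card.empty leafless_def outdegree_def)

lemma Chi_n_Suc: "Chi_n V E (Suc n) u = (\<Union>w\<in>Chi V E u. Chi_n V E n w)"
  by (auto simp: Chi_n_def Chi_def bind_eq_Some_conv dest: par_iter_in_V)

lemma finite_Chi_n: "finite (Chi_n V E n u)"
proof (induction n arbitrary: u)
  case 0
  have "Chi_n V E 0 u \<subseteq> {u}" by (auto simp: Chi_n_def)
  then show ?case by (rule finite_subset) simp
qed (simp add: Chi_n_Suc finite_Chi)

lemma Chi_n_nonempty: "u \<in> V \<Longrightarrow> Chi_n V E n u \<noteq> {}"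
proof (induction n arbitrary: u)
  case (Suc n)
  then obtain w where "w \<in> Chi V E u"
    using Chi_nonempty by blast
  with Suc.IH[of w] show ?case
    by (auto simp: Chi_n_Suc Chi_def)
qed (auto simp: Chi_n_def)

lemma gam_pos: "u \<in> V \<Longrightarrow> 0 < gam V E u n"
  using finite_Chi_n Chi_n_nonempty by (simp add: gam_def card_gt_0_iff)

section \<open>The spread functions and the powers of the shift\<close>

lemma spread_outside:
  assumes "v \<notin> V" "f v = 0"
  shows "spread V E n f v = 0"
proof -
  have "par E v = None"
    using assms by (metis edge_in_V not_None_eq par_eq_Some_iff)
  \<comment> \<open>The second case is \<open>n = 0\<close>, where the iterate is
    \<open>Some v\<close> even outside \<open>V\<close>; hence the hypothesis
    \<open>f v = 0\<close>.\<close>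
  then have "par_iter E n v = None \<or> par_iter E n v = Some v"
    by (induction n) auto
  with assms show ?thesis
    by (auto simp: spread_def)
qed

text \<open>The generation splits over the children of \<open>u\<close>; the parts are disjoint
  because an \<open>n\<close>-th ancestor is unique.\<close>

lemma backward_shift_funpow:
  assumes "u \<in> V"
  shows "(backward_shift V E ^^ n) f u = (\<Sum>v\<in>Chi_n V E n u. f v)"
  using assms
proof (induction n arbitrary: u)
  case 0
  then have "Chi_n V E 0 u = {u}" by (auto simp: Chi_n_def)
  then show ?case by simp
next
  case (Suc n)
  have "(backward_shift V E ^^ Suc n) f u = (\<Sum>w\<in>Chi V E u. (backward_shift V E ^^ n) f w)"
    using Suc.prems backward_shift_def[of V E "(backward_shift V E ^^ n) f"] by simp
  also have "\<dots> = (\<Sum>w\<in>Chi V E u. \<Sum>v\<in>Chi_n V E n w. f v)"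
    by (intro sum.cong Suc.IH) (auto simp: Chi_def)
  also have "\<dots> = (\<Sum>v\<in>Chi_n V E (Suc n) u. f v)"
    unfolding Chi_n_Suc
    by (intro sum.UNION_disjoint[symmetric]) (auto simp: finite_Chi finite_Chi_n, auto simp: Chi_n_def)
  finally show ?case .
qed

text \<open>With \<open>backward_shift_funpow\<close> this is the right inverse property on
  \<open>V\<close>. Leaflessness enters through \<open>gam_pos\<close>.\<close>

lemma sum_spread:
  assumes "u \<in> V"
  shows "(\<Sum>v\<in>Chi_n V E n u. spread V E n f v) = f u"
proof -
  have "(\<Sum>v\<in>Chi_n V E n u. spread V E n f v) = (\<Sum>v\<in>Chi_n V E n u. f u / of_nat (gam V E u n))"
    by (intro sum.cong) (auto simp: spread_def Chi_n_def)
  also have "\<dots> = f u"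
    using gam_pos[OF assms, of n] by (simp add: gam_def)
  finally show ?thesis .
qed

text \<open>On the generation below \<open>u\<close> the spread function is constant, so the weights
  there collect exactly into \<open>Omega\<close>; only the restriction to \<open>F\<close> loses
  anything.\<close>

lemma spread_norm_le:
  assumes F: "finite F" "F \<subseteq> V" and A: "finite A" "A \<subseteq> V" and f: "\<And>v. v \<notin> A \<Longrightarrow> f v = 0"
    and lam: "\<And>v. v \<in> V \<Longrightarrow> 0 \<le> lam v"
  shows "(\<Sum>v\<in>F. cmod (spread V E n f v) powr q * lam v)
    \<le> (\<Sum>u\<in>A. cmod (f u) powr q * Omega V E lam q u n)"
proof -
  let ?t = "\<lambda>v. cmod (spread V E n f v) powr q * lam v" and ?U = "\<Union>u\<in>A. Chi_n V E n u"
  have "(\<Sum>v\<in>F. ?t v) = (\<Sum>v\<in>F \<inter> ?U. ?t v)"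
    using F f by (intro sum.mono_neutral_right) (auto simp: spread_def Chi_n_def split: option.split)
  also have "\<dots> \<le> (\<Sum>v\<in>?U. ?t v)"
    using A by (intro sum_mono2) (auto simp: finite_Chi_n, auto simp: Chi_n_def lam)
  also have "\<dots> = (\<Sum>u\<in>A. \<Sum>v\<in>Chi_n V E n u. ?t v)"
    using A by (intro sum.UNION_disjoint) (auto simp: finite_Chi_n, auto simp: Chi_n_def)
  also have "\<dots> = (\<Sum>u\<in>A. cmod (f u) powr q * Omega V E lam q u n)"
  proof (rule sum.cong)
    fix u
    have "(\<Sum>v\<in>Chi_n V E n u. ?t v)
        = (\<Sum>v\<in>Chi_n V E n u. cmod (f u) powr q * (1 / real (gam V E u n) powr q * lam v))"
      by (intro sum.cong) (auto simp: spread_def Chi_n_def norm_divide powr_divide)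
    then show "(\<Sum>v\<in>Chi_n V E n u. ?t v) = cmod (f u) powr q * Omega V E lam q u n"
      by (simp add: Omega_def flip: sum_distrib_left sum_divide_distrib)
  qed simp
  finally show ?thesis .
qed

end


section \<open>The hypercyclic vector\<close>

theorem theorem5p1:
  fixes V :: "'v set" and E :: "('v \<times> 'v) set"
    and lam :: "'v \<Rightarrow> real" and q :: real
  assumes "directed_tree V E"
    and "leafless V E"
    and "\<exists>r. is_root V E r"
    and "\<forall>v\<in>V. lam v > 0"
    and "1 \<le> q"
    and "bounded_operator (Lq V lam q) (Lq_norm V lam q) (backward_shift V E)"
    and "\<exists>n :: nat \<Rightarrow> nat. strict_mono n \<and> (\<forall>k. n k \<ge> 1) \<and>
           (\<forall>u\<in>V. (\<lambda>k. Omega V E lam q u (n k)) \<longlonglongrightarrow> 0)"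
  shows "hypercyclic (Lq V lam q) (Lq_norm V lam q) (backward_shift V E)"
proof -
  interpret leafless_rooted_tree V E
    using assms(1-3) by unfold_locales
  note lam_q = \<open>\<forall>v\<in>V. lam v > 0\<close> \<open>1 \<le> q\<close>
  let ?X = "Lq V lam q" and ?p = "Lq_pow V lam q" and ?B = "backward_shift V E"

  obtain n :: "nat \<Rightarrow> nat" where n: "strict_mono n"
    and Om: "\<And>u. u \<in> V \<Longrightarrow> (\<lambda>k. Omega V E lam q u (n k)) \<longlonglongrightarrow> 0"
    using assms(7) by blast
  obtain K where K: "1 \<le> K"
    and B: "\<forall>f\<in>?X. \<forall>n. (?B ^^ n) f \<in> ?X \<and> ?p ((?B ^^ n) f) \<le> K ^ n * ?p f"
    using bounded_operator_iterates[OF lam_q assms(6)] by (elim exE conjE)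
  have B_mem: "(?B ^^ n) f \<in> ?X" and B_le: "?p ((?B ^^ n) f) \<le> K ^ n * ?p f"
    if "f \<in> ?X" for f n
    using B[rule_format, OF that] by (rule conjunct1, rule conjunct2)
  have "countable V" "V \<noteq> {}"
    using assms(1) by (auto simp: directed_tree_def locally_finite_digraph_def)
  from Lq_dense_sequence[OF lam_q this] obtain g :: "nat \<Rightarrow> 'v \<Rightarrow> complex" and G where
    G': "\<forall>i. finite (G i) \<and> G i \<subseteq> V \<and> (\<forall>v. v \<notin> G i \<longrightarrow> g i v = 0)"
    and dense: "\<forall>f\<in>?X. \<forall>e>0. \<exists>i. ?p (\<lambda>v. g i v - f v) < e"
    by (elim exE conjE)
  have G: "finite (G i)" "G i \<subseteq> V" "v \<notin> G i \<Longrightarrow> g i v = 0" for i v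
    using G' by simp_all

  text \<open>Every \<open>g i\<close> occurs infinitely often among the \<open>y j\<close>.\<close>
  define y where "y j = g (fst (prod_decode j))" for j
  define A where "A j = G (fst (prod_decode j))" for j
  have A: "finite (A j)" "A j \<subseteq> V" and y0: "v \<notin> A j \<Longrightarrow> y j v = 0" for j v
    using G by (auto simp: A_def y_def)
  \<comment> \<open>By \<open>spread_norm_le\<close> this bounds the \<open>q\<close>-th power of
    the norm of \<open>spread V E m (y j)\<close>.\<close>
  define a where "a j m = (\<Sum>u\<in>A j. cmod (y j u) powr q * Omega V E lam q u m)" for j m
  \<comment> \<open>The sum serves as an explicit upper bound for the depths on
    \<open>A j\<close>.\<close>
  define d where "d j = (\<Sum>u\<in>A j. depth E u)" for j
  have d: "depth E u \<le> d j" if "u \<in> A j" for u j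
    unfolding d_def using A that by (intro member_le_sum) auto

  \<comment> \<open>Choice of the powers \<open>m i\<close>\<close>
  have choice: "\<exists>m>N. a j m < e" if "0 < e" for j N e
  proof -
    have "(\<lambda>k. a j (n k)) \<longlonglongrightarrow> 0"
      unfolding a_def using A by (intro tendsto_null_sum tendsto_mult_right_zero Om) auto
    then have "\<forall>\<^sub>F k in sequentially. a j (n k) < e \<and> N < k"
      using that by (intro eventually_conj order_tendstoD(2) eventually_gt_at_top)
    then obtain k where "a j (n k) < e" "N < k"
      by (auto simp: eventually_sequentially)
    with seq_suble[OF n, of k] show ?thesis
      by (intro exI[of _ "n k"]) linarith
  qed
  \<comment> \<open>The gap \<open>d i\<close> separates the depth ranges of consecutive terms;
    dividing by \<open>K ^ m i\<close> keeps a new term small under the powers of the shift chosen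
    before it.\<close>
  have "\<exists>m. \<forall>i. a i (m i) \<le> (1 / 2) ^ i \<and>
    (m i + d i < m (Suc i) \<and> a (Suc i) (m (Suc i)) \<le> (1 / 2) ^ Suc i / K ^ m i)"
  proof (rule dependent_nat_choice)
    show "\<exists>m. a 0 m \<le> (1 / 2) ^ 0"
      using choice[of 1 0 0] by (auto intro: less_imp_le)
    fix i m
    have "0 < (1 / 2 :: real) ^ Suc i / K ^ m"
      using K by simp
    from choice[OF this] obtain m' where m': "m + d i < m'" "a (Suc i) m' < (1 / 2) ^ Suc i / K ^ m"
      by blast
    have "(1 / 2 :: real) ^ Suc i / K ^ m \<le> (1 / 2) ^ Suc i / 1"
      using K by (intro divide_left_mono) auto
    with m' show "\<exists>m'. a (Suc i) m' \<le> (1 / 2) ^ Suc i \<and>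
        (m + d i < m' \<and> a (Suc i) m' \<le> (1 / 2) ^ Suc i / K ^ m)"
      by (intro exI[of _ m']) linarith
  qed
  then obtain m where a_le: "\<And>i. a i (m i) \<le> (1 / 2) ^ i"
    and m_Suc: "\<And>i. m i + d i < m (Suc i)"
    and a_Suc: "\<And>i. a (Suc i) (m (Suc i)) \<le> (1 / 2) ^ Suc i / K ^ m i"
    by blast
  have m: "strict_mono m"
    by (intro strict_mono_Suc_iff[THEN iffD2] allI add_lessD1[OF m_Suc])
  \<comment> \<open>The recursion compares \<open>i\<close> only with its predecessor; since
    \<open>K\<close> is at least 1, that bound implies those for all smaller
    \<open>j\<close>.\<close>
  have a_less: "a i (m i) \<le> (1 / 2) ^ i / K ^ m j" if "j < i" for i j
  proof -
    obtain l where i: "i = Suc l" "j \<le> l"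
      using \<open>j < i\<close> by (cases i) auto
    then have "K ^ m j \<le> K ^ m l"
      using K m by (intro power_increasing) (auto simp: strict_mono_less_eq)
    then have "(1 / 2 :: real) ^ i / K ^ m l \<le> (1 / 2) ^ i / K ^ m j"
      using K by (intro divide_left_mono) auto
    with a_Suc[of l] show ?thesis
      unfolding i(1) by (rule order_trans)
  qed

  text \<open>The functions \<open>spread V E (m i) (y i)\<close> live on the disjoint depth intervals
    \<open>m i < depth \<le> m (Suc i)\<close>, so that their sum \<open>x\<close> needs no series.\<close>
  let ?S = "\<lambda>i. spread V E (m i) (y i)"
  define block where "block v = (LEAST i. depth E v \<le> m (Suc i))" for v
  define x where "x v = ?S (block v) v" for v
  have block_ge: "depth E v \<le> m (Suc (block v))" for v
    unfolding block_def
    by (rule LeastI[of _ "depth E v"]) (rule order_trans[OF _ seq_suble[OF m]], simp)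
  \<comment> \<open>Vertices in the support of term \<open>i\<close> have depth
    \<open>m i + depth E w\<close> with \<open>w\<close> in \<open>A i\<close>, which is above
    \<open>m i\<close> and at most \<open>m i + d i\<close>.\<close>
  have S_block: "block v = i" if v: "v \<in> V" and S: "?S i v \<noteq> 0" for v i
  proof -
    obtain w where w: "par_iter E (m i) v = Some w" "y i w \<noteq> 0"
      using S by (auto simp: spread_def split: option.splits)
    then have dv: "depth E v = m i + depth E w"
      using depth_eq_add v by blast
    have "w \<in> A i" "w \<in> V"
      using w y0 par_iter_in_V[OF v w(1)] by blast+
    then have "depth E v \<le> m (Suc i)" "m i < depth E v"
      using dv d[of w i] m_Suc[of i] depth_pos[of w] by auto
    moreover have "i \<le> j" if "depth E v \<le> m (Suc j)" for j
      using that \<open>m i < depth E v\<close> strict_mono_less[OF m, of i "Suc j"] by linarith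
    ultimately show ?thesis
      unfolding block_def by (intro Least_equality)
  qed
  \<comment> \<open>Grouping \<open>F\<close> by blocks, \<open>x\<close> agrees on block
    \<open>i\<close> with a single spread function.\<close>
  have x_sum: "(\<Sum>v\<in>F. cmod (x v) powr q * lam v) \<le> (\<Sum>i\<in>block ` F. a i (m i))"
    if F: "finite F" "F \<subseteq> V" for F
  proof -
    have "(\<Sum>v\<in>F. cmod (x v) powr q * lam v)
        = (\<Sum>i\<in>block ` F. \<Sum>v | v \<in> F \<and> block v = i. cmod (?S i v) powr q * lam v)"
      unfolding sum.image_gen[OF F(1), of _ block]
      by (intro sum.cong) (auto simp: x_def)
    also have "\<dots> \<le> (\<Sum>i\<in>block ` F. a i (m i))"
      unfolding a_def using F A y0 lam_q by (intro sum_mono spread_norm_le) (auto intro: less_imp_le)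
    finally show ?thesis .
  qed
  have x_outside: "x v = 0" if "v \<notin> V" for v
    unfolding x_def using that A(2) by (intro spread_outside y0) auto
  have x_mem: "x \<in> ?X"
  proof (rule Lq_boundedI[OF lam_q x_outside])
    fix F assume F: "finite F" "F \<subseteq> V"
    have "(\<Sum>i\<in>block ` F. a i (m i)) \<le> (\<Sum>i\<in>block ` F. (1 / 2) ^ i)"
      by (intro sum_mono a_le)
    also have "\<dots> \<le> 2 * (1 / 2) ^ 0"
      using F by (intro sum_half_powers_le) auto
    finally show "(\<Sum>v\<in>F. cmod (x v) powr q * lam v) \<le> 2 * (1 / 2) ^ 0"
      using x_sum[OF F] by linarith
  qed

  \<comment> \<open>The tail of \<open>x\<close> beyond block \<open>j\<close>.\<close>
  define t where "t j v = (if j < block v then x v else 0)" for j v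
  have t: "t j \<in> ?X" "?p (t j) \<le> (1 / 2) ^ j / K ^ m j" for j
  proof -
    have bound: "(\<Sum>v\<in>F. cmod (t j v) powr q * lam v) \<le> (1 / 2) ^ j / K ^ m j"
      if F: "finite F" "F \<subseteq> V" for F
    proof -
      let ?F = "{v \<in> F. j < block v}"
      have "(\<Sum>v\<in>F. cmod (t j v) powr q * lam v) = (\<Sum>v\<in>?F. cmod (x v) powr q * lam v)"
        using F by (intro sum.mono_neutral_cong_right) (auto simp: t_def)
      also have "\<dots> \<le> (\<Sum>i\<in>block ` ?F. a i (m i))"
        using F by (intro x_sum) auto
      also have "\<dots> \<le> (\<Sum>i\<in>block ` ?F. (1 / 2) ^ i / K ^ m j)"
        by (intro sum_mono a_less) auto
      also have "\<dots> = (\<Sum>i\<in>block ` ?F. (1 / 2) ^ i) / K ^ m j"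
        by (rule sum_divide_distrib[symmetric])
      \<comment> \<open>The tail starts at index \<open>Suc j\<close>, which cancels the factor 2 of
        the geometric sum.\<close>
      also have "\<dots> \<le> 2 * (1 / 2) ^ Suc j / K ^ m j"
        using F K by (intro divide_right_mono sum_half_powers_le) auto
      finally show ?thesis by simp
    qed
    have "t j v = 0" if "v \<notin> V" for v
      using that by (simp add: t_def x_outside)
    from Lq_boundedI[OF lam_q this bound] show "t j \<in> ?X" "?p (t j) \<le> (1 / 2) ^ j / K ^ m j"
      by auto
  qed
  have Bt: "?p ((?B ^^ m j) (t j)) \<le> (1 / 2) ^ j" for j
  proof -
    have "?p ((?B ^^ m j) (t j)) \<le> K ^ m j * ((1 / 2) ^ j / K ^ m j)"
      using K by (intro order_trans[OF B_le[OF t(1)]] mult_left_mono t(2)) auto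
    with K show ?thesis by simp
  qed
  have Bx: "(?B ^^ m j) x u = y j u + (?B ^^ m j) (t j) u" if u: "u \<in> V" for j u
  proof -
    \<comment> \<open>A vertex with an \<open>m j\<close>-th ancestor is deeper than
      \<open>m j\<close>, so the terms before \<open>j\<close> do not reach it.\<close>
    have "x v = ?S j v + t j v" if "v \<in> Chi_n V E (m j) u" for v
    proof -
      have v: "v \<in> V" "par_iter E (m j) v = Some u"
        using that by (auto simp: Chi_n_def)
      then have "m j < depth E v"
        by (simp add: less_depth_iff)
      then have "j \<le> block v"
        using block_ge[of v] strict_mono_less[OF m, of j "Suc (block v)"] by linarith
      moreover have "?S j v = 0" if "j < block v"
        using S_block[OF v(1), of j] that by auto
      ultimately show ?thesis
        by (auto simp: t_def x_def)
    qed
    then have "(?B ^^ m j) x u = (\<Sum>v\<in>Chi_n V E (m j) u. ?S j v + t j v)"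
      using u by (simp add: backward_shift_funpow)
    then show ?thesis
      using u by (simp add: sum.distrib sum_spread backward_shift_funpow)
  qed

  \<comment> \<open>Density of the orbit\<close>
  have "\<exists>n. Lq_norm V lam q (\<lambda>v. (?B ^^ n) x v - f v) < e" if f: "f \<in> ?X" and e: "0 < e" for f e
  proof -
    \<comment> \<open>Solves \<open>2 powr q * (h + h) = e powr q\<close>, matching the constant in
      \<open>Lq_pow_add_le\<close>.\<close>
    define h where "h = (e / 2) powr q / 2"
    have h: "0 < h"
      using e by (simp add: h_def)
    obtain i where i: "?p (\<lambda>v. g i v - f v) < h"
      using dense f h by blast
    obtain N where N: "(1 / 2 :: real) ^ N < h"
      using real_arch_pow_inv[OF h, of "1 / 2"] by auto
    \<comment> \<open>Pairing with \<open>N\<close> gives an occurrence of \<open>g i\<close> at an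
      index of at least \<open>N\<close>.\<close>
    define j where "j = prod_encode (i, N)"
    have j: "y j = g i" "N \<le> j"
      by (simp_all add: j_def y_def le_prod_encode_2)
    then have "(1 / 2 :: real) ^ j \<le> (1 / 2) ^ N"
      by (intro power_decreasing) auto
    with Bt[of j] N have Bt_j: "?p ((?B ^^ m j) (t j)) < h"
      by linarith
    have eq: "(\<lambda>v. (?B ^^ m j) x v - f v) = (\<lambda>v. (g i v - f v) + (?B ^^ m j) (t j) v)"
    proof
      fix v
      show "(?B ^^ m j) x v - f v = (g i v - f v) + (?B ^^ m j) (t j) v"
        using Bx[of v j] B_mem[OF x_mem, of "m j"] B_mem[OF t(1), of "m j" j] j G(2,3)
        by (cases "v \<in> V") (auto simp: Lq_def subset_iff)
    qed
    have "g i \<in> ?X"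
      using G by (intro finite_support_in_Lq[OF lam_q, of "G i"])
    then have "(\<lambda>v. g i v - f v) \<in> ?X"
      using Lq_pow_add_le(1)[OF lam_q _ Lq_uminus[OF lam_q f], of "g i"] by simp
    then have "?p (\<lambda>v. (?B ^^ m j) x v - f v)
        \<le> 2 powr q * (?p (\<lambda>v. g i v - f v) + ?p ((?B ^^ m j) (t j)))"
      unfolding eq by (intro Lq_pow_add_le(2)[OF lam_q] B_mem t)
    also have "\<dots> < 2 powr q * (h + h)"
      using i Bt_j by (intro mult_strict_left_mono add_strict_mono) auto
    also have "\<dots> = e powr q"
      using e by (simp add: h_def powr_divide)
    finally show ?thesis
      using Lq_norm_less_iff[OF lam_q e] by blast
  qed
  then show ?thesis
    unfolding hypercyclic_def using assms(6) x_mem by blast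
qed

end
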